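(* Let $d\ge 1$, let $\Omega\subset\mathbb{C}^d$ be an open set (bounded or unbounded), and let $(K_m)_{m\ge 1}$ be a sequence of compact subsets of $\Omega$ with $K_m\subset K_{m+1}^{o}$ for all $m$ and $\bigcup_{m=1}^{\infty}K_m=\Omega$. Set $\Omega_m=K_m^{o}$ (the interior of $K_m$). For each $m=1,2,\dots$ let $X_m(\Omega_m)$ be an arbitrary topological space belonging to the class $M(\Omega_m)$. For $n\le m$ let $T_{m,n}\colon X_m(\Omega_m)\to X_n(\Omega_n)$ be the restriction map $T_{m,n}(f)=f|_{\Omega_n}$, and let $X$ be the projective limit of the family $(X_m(\Omega_m))_{m\ge1}$ with respect to the maps $T_{m,n}$. Then the topological space $X$ is homeomorphic to $H(\Omega)$.
   Context: For an open set $G\subset\mathbb{C}^d$, $H(G)$ denotes the space of all holomorphic functions $G\to\mathbb{C}$ with the topology of uniform convergence on compact subsets of $G$. For a bounded open set $G\subset\mathbb{C}^d$, $A^{\infty}(G)$ denotes the set of holomorphic functions $f$ on $G$ such that every mixed partial derivative of $f$ (of every order, including order $0$) extends continuously to the closure $\overline{G}$. Its topology is the one defined by the seminorms $\sup_{z\in G}\left|\frac{\partial^{a_1+\dots+a_d}f}{\partial z_1^{a_1}\cdots\partial z_d^{a_d}}(z)\right|$, $a_1,\dots,a_d\in\{0,1,2,\dots\}$. For a bounded open set $G\subset\mathbb{C}^d$, $M(G)$ denotes the class of all topological spaces $X(G)$ whose underlying set is a set of functions with $A^{\infty}(G)\subset X(G)\subset H(G)$ and such that both inclusion maps $A^{\infty}(G)\to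 X(G)$, $f\mapsto f$, and $X(G)\to H(G)$, $g\mapsto g$, are continuous (where $A^{\infty}(G)$ carries the topology defined by the seminorms $\sup_{z\in G}\left|\frac{\partial^{a_1+\dots+a_d}f}{\partial z_1^{a_1}\cdots\partial z_d^{a_d}}(z)\right|$, $a_1,\dots,a_d\in\{0,1,2,\dots\}$, and $H(G)$ carries the topology of uniform convergence on compact subsets of $G$). An element of $M(G)$ is not required to be complete, nor to be a vector space. Under the hypotheses of the claim, each $\Omega_m$ is a bounded open set with $\Omega_m\subset\overline{\Omega_m}\subset\Omega_{m+1}$; the restriction maps $T_{m,n}$ ($n\le m$) are well defined and continuous, $T_{n,n}$ is the identity, and $T_{m,n}=T_{s,n}\circ T_{m,s}$ for $n\le s\le m$. Projective limit: given topological spaces $Y_n$ ($n=1,2,\dots$) and continuous maps $T_{m,n}\colon Y_m\to Y_n$ for $n\le m$, with $T_{n,n}$ the identity and $T_{m,n}=T_{s,n}\circ T_{m,s}$ for $n\le s\le m$, the projective (inverse) limit is the set $Y=\{(g_1,g_2,\dots)\in\prod_{n=1}^{\infty}Y_n : T_{m,n}(g_m)=g_n \text{ for all } n\le m\}$ with the subspace topology inherited from the product topology on $\prod_{n=1}^{\infty}Y_n$. *)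

theory Defs
  imports "HOL-Analysis.Analysis"
begin

text \<open>
  The space $\mathbb{C}^d$ is \<^typ>\<open>complex ^ 'n\<close> with $d = $ \<open>CARD('n)\<close> (so $d \ge 1$).
  A function $G \to \mathbb{C}$ is represented by an element of \<^term>\<open>extensional G\<close>, so
  that distinct representatives are distinct functions on \<open>G\<close> and restriction is
  \<^const>\<open>restrict\<close>. All sets \<open>G\<close> below are meant to be open.
\<close>

definition holomorphic_Cn :: "(complex ^ 'n \<Rightarrow> complex) \<Rightarrow> (complex ^ 'n) set \<Rightarrow> bool" where
  "holomorphic_Cn f G \<longleftrightarrow>
     (\<forall>z\<in>G. \<exists>L. (f has_derivative L) (at z) \<and> (\<forall>c v. L (c *s v) = c * L v))"

definition H_set :: "(complex ^ 'n) set \<Rightarrow> (complex ^ 'n \<Rightarrow> complex) set" where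
  "H_set G = {f \<in> extensional G. holomorphic_Cn f G}"

definition partial_z :: "'n \<Rightarrow> (complex ^ 'n \<Rightarrow> complex) \<Rightarrow> complex ^ 'n \<Rightarrow> complex" where
  "partial_z j f z = deriv (\<lambda>w. f (z + axis j w)) 0"

text \<open>
  The index type carries no order, so an arbitrary enumeration of it plays the role of
  $1,\dots,d$. The choice is immaterial for holomorphic functions, whose partial derivatives
  commute.
\<close>

definition coords :: "'n::finite list" where
  "coords = (SOME js. distinct js \<and> set js = UNIV)"

definition mixed_partial ::
    "('n \<Rightarrow> nat) \<Rightarrow> (complex ^ 'n \<Rightarrow> complex) \<Rightarrow> complex ^ 'n \<Rightarrow> complex" where
  "mixed_partial a f = foldr (\<lambda>j. partial_z j ^^ a j) coords f"

definition A_inf_set :: "(complex ^ 'n) set \<Rightarrow> (complex ^ 'n \<Rightarrow> complex) set" where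
  "A_inf_set G = {f \<in> H_set G. \<forall>a. \<exists>h. continuous_on (closure G) h \<and>
                                        (\<forall>z\<in>G. h z = mixed_partial a f z)}"

definition seminorm_topology ::
    "('a \<Rightarrow> complex) set \<Rightarrow> (('a \<Rightarrow> complex) \<Rightarrow> real) set \<Rightarrow> ('a \<Rightarrow> complex) topology" where
  "seminorm_topology S P = topology (\<lambda>U. U \<subseteq> S \<and>
     (\<forall>f\<in>U. \<exists>F e. finite F \<and> F \<subseteq> P \<and> 0 < e \<and>
              {g \<in> S. \<forall>p\<in>F. p (\<lambda>x. g x - f x) < e} \<subseteq> U))"

lemma openin_seminorm_topology:
  "openin (seminorm_topology S P) U \<longleftrightarrow> U \<subseteq> S \<and>
     (\<forall>f\<in>U. \<exists>F e. finite F \<and> F \<subseteq> P \<and> 0 < e \<and>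
              {g \<in> S. \<forall>p\<in>F. p (\<lambda>x. g x - f x) < e} \<subseteq> U)"
proof -
  let ?N = "\<lambda>f F e. {g \<in> S. \<forall>p\<in>F. p (\<lambda>x. g x - f x) < (e::real)}"
  let ?ok = "\<lambda>f U. \<exists>F e. finite F \<and> F \<subseteq> P \<and> 0 < e \<and> ?N f F e \<subseteq> U"
  have "istopology (\<lambda>U. U \<subseteq> S \<and> (\<forall>f\<in>U. ?ok f U))"
    unfolding istopology_def
  proof (rule conjI; intro allI impI)
    fix U V
    assume U: "U \<subseteq> S \<and> (\<forall>f\<in>U. ?ok f U)" and V: "V \<subseteq> S \<and> (\<forall>f\<in>V. ?ok f V)"
    have "?ok f (U \<inter> V)" if f: "f \<in> U \<inter> V" for f
    proof -
      from f U have "?ok f U" by simp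
      then obtain F e where 1: "finite F" "F \<subseteq> P" "0 < e" "?N f F e \<subseteq> U" by (elim exE conjE)
      from f V have "?ok f V" by simp
      then obtain F' e' where 2: "finite F'" "F' \<subseteq> P" "0 < e'" "?N f F' e' \<subseteq> V" by (elim exE conjE)
      have "?N f (F \<union> F') (min e e') \<subseteq> ?N f F e \<inter> ?N f F' e'" by auto
      also from 1 2 have "\<dots> \<subseteq> U \<inter> V" by (intro Int_mono)
      finally have "?N f (F \<union> F') (min e e') \<subseteq> U \<inter> V" .
      with 1(1-3) 2(1-3) show ?thesis
        by (intro exI[of _ "F \<union> F'"] exI[of _ "min e e'"] conjI) simp_all
    qed
    moreover from U have "U \<inter> V \<subseteq> S" by (simp add: le_infI1)
    ultimately show "U \<inter> V \<subseteq> S \<and> (\<forall>f\<in>U \<inter> V. ?ok f (U \<inter> V))" by simp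
  next
    fix \<K> assume K: "\<forall>U\<in>\<K>. U \<subseteq> S \<and> (\<forall>f\<in>U. ?ok f U)"
    have "?ok f (\<Union>\<K>)" if f: "f \<in> \<Union>\<K>" for f
    proof -
      from f obtain U where U: "U \<in> \<K>" "f \<in> U" by blast
      with K have "?ok f U" by simp
      then obtain F e where 1: "finite F" "F \<subseteq> P" "0 < e" "?N f F e \<subseteq> U" by (elim exE conjE)
      from 1(4) Union_upper[OF U(1)] have "?N f F e \<subseteq> \<Union>\<K>" by (rule subset_trans)
      with 1 show ?thesis by (intro exI conjI)
    qed
    moreover from K have "\<Union>\<K> \<subseteq> S" by (simp add: Union_least)
    ultimately show "\<Union>\<K> \<subseteq> S \<and> (\<forall>f\<in>\<Union>\<K>. ?ok f (\<Union>\<K>))" by simp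
  qed
  then show ?thesis
    unfolding seminorm_topology_def by simp
qed

lemma topspace_seminorm_topology [simp]: "topspace (seminorm_topology S P) = S"
proof -
  have "openin (seminorm_topology S P) S"
    unfolding openin_seminorm_topology by (auto intro!: exI[of _ "{}"] exI[of _ "1::real"])
  then show ?thesis
    by (metis openin_seminorm_topology openin_subset openin_topspace subset_antisym)
qed

text \<open>The element 0 is inserted so that the supremum over the empty set is 0.\<close>

definition sup_seminorm :: "'a set \<Rightarrow> ('a \<Rightarrow> complex) \<Rightarrow> real" where
  "sup_seminorm S f = Sup (insert 0 ((\<lambda>z. norm (f z)) ` S))"

definition H_top :: "(complex ^ 'n) set \<Rightarrow> (complex ^ 'n \<Rightarrow> complex) topology" where
  "H_top G = seminorm_topology (H_set G) {sup_seminorm K | K. compact K \<and> K \<subseteq> G}"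

definition A_inf_top :: "(complex ^ 'n) set \<Rightarrow> (complex ^ 'n \<Rightarrow> complex) topology" where
  "A_inf_top G = seminorm_topology (A_inf_set G)
     (range (\<lambda>a f. sup_seminorm G (mixed_partial a f)))"

definition class_M :: "(complex ^ 'n) set \<Rightarrow> (complex ^ 'n \<Rightarrow> complex) topology set" where
  "class_M G = {X. A_inf_set G \<subseteq> topspace X \<and> topspace X \<subseteq> H_set G \<and>
                   continuous_map (A_inf_top G) X (\<lambda>f. f) \<and>
                   continuous_map X (H_top G) (\<lambda>g. g)}"

definition projective_limit ::
    "(nat \<Rightarrow> 'a topology) \<Rightarrow> (nat \<Rightarrow> nat \<Rightarrow> 'a \<Rightarrow> 'a) \<Rightarrow> (nat \<Rightarrow> 'a) topology" where
  "projective_limit Y T = subtopology (product_topology Y {1..})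
     {g. \<forall>n m. 1 \<le> n \<longrightarrow> n \<le> m \<longrightarrow> T m n (g m) = g n}"

end

theory Submission
  imports Defs "HOL-Complex_Analysis.Cauchy_Integral_Formula"
begin

text \<open>
  Restricting \<open>f\<close> to each set \<open>\<Omega>\<^sub>n\<close>, the interior of \<open>K n\<close>, gives the homeomorphism from \<open>H(\<Omega>)\<close>
  to the projective limit. A compatible sequence \<open>(g\<^sub>n)\<close> glues to one function on \<open>\<Omega>\<close>, because the
  sets \<open>\<Omega>\<^sub>n\<close> increase to \<open>\<Omega>\<close>; the glued function is holomorphic, because each \<open>g\<^sub>n\<close> is. So
  restriction and gluing are mutually inverse. The spaces \<open>X\<^sub>n\<close> enter only through their being caught
  between \<open>A\<^sup>\<infinity>(\<Omega>\<^sub>n)\<close> and \<open>H(\<Omega>\<^sub>n)\<close>.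

  Gluing is continuous for the cheap reason: a compact subset of \<open>\<Omega>\<close> lies in some \<open>\<Omega>\<^sub>n\<close>, so its
  seminorm only reads the coordinate \<open>g\<^sub>n\<close>, and \<open>X\<^sub>n \<rightarrow> H(\<Omega>\<^sub>n)\<close> is continuous.

  Restriction is where analysis is needed. By \<open>A\<^sup>\<infinity>(\<Omega>\<^sub>n) \<rightarrow> X\<^sub>n\<close> it suffices that \<open>H(\<Omega>) \<rightarrow> A\<^sup>\<infinity>(\<Omega>\<^sub>n)\<close>
  is well defined and continuous (\<open>restrict_in_A_inf_set\<close>, \<open>continuous_map_restrict_A_inf\<close>). Since the
  closure of \<open>\<Omega>\<^sub>n\<close> is a compact subset of \<open>\<Omega>\<close>, the first holds as soon as mixed partial derivatives
  of a holomorphic function are continuous on \<open>\<Omega>\<close> (\<open>cont_sep_holomorphic_mixed_partial\<close>), and the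
  second is the Cauchy estimate: on a compact set they are bounded by a constant times the supremum
  of the function over a larger compact set (\<open>mixed_partial_Cauchy_estimate\<close>).
\<close>

section \<open>Continuous separately holomorphic functions\<close>

lemma axis_plus: "axis j (v + w) = axis j v + (axis j w :: 'a::monoid_add ^ 'n)"
  by (simp add: vec_eq_iff axis_def)

lemma axis_zero: "axis j 0 = (0 :: 'a::zero ^ 'n)"
  by (simp add: vec_eq_iff axis_def)

lemma norm_axis: "norm (axis j w :: 'a::real_normed_vector ^ 'n) = norm w"
proof -
  have "(\<Sum>i\<in>UNIV. (norm ((axis j w :: 'a ^ 'n) $ i))\<^sup>2) = (\<Sum>i\<in>UNIV. if i = j then (norm w)\<^sup>2 else 0)"
    by (rule sum.cong) (auto simp: axis_def)
  then show ?thesis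
    by (simp add: norm_vec_def L2_set_def)
qed

text \<open>
  By Osgood's lemma these are exactly the holomorphic functions if \<open>G\<close> is open. For iterating partial
  derivatives this form is the convenient one: differentiating along a coordinate preserves it by
  one-variable arguments alone.
\<close>

definition cont_sep_holomorphic :: "(complex ^ 'n \<Rightarrow> complex) \<Rightarrow> (complex ^ 'n) set \<Rightarrow> bool" where
  "cont_sep_holomorphic f G \<longleftrightarrow> continuous_on G f \<and>
     (\<forall>z\<in>G. \<forall>j. (\<lambda>w. f (z + axis j w)) field_differentiable at 0)"

lemma holomorphic_Cn_imp_continuous_on:
  assumes "holomorphic_Cn f G"
  shows "continuous_on G f"
  using assms unfolding holomorphic_Cn_def
  by (meson continuous_at_imp_continuous_on has_derivative_continuous)

lemma holomorphic_Cn_imp_cont_sep_holomorphic: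
  fixes G :: "(complex ^ 'n) set"
  assumes "holomorphic_Cn f G"
  shows "cont_sep_holomorphic f G"
  unfolding cont_sep_holomorphic_def
proof (intro conjI ballI allI)
  show "continuous_on G f"
    using assms by (rule holomorphic_Cn_imp_continuous_on)
  fix z j assume "z \<in> G"
  then obtain L where L: "(f has_derivative L) (at z)" and homog: "\<And>c v. L (c *s v) = c * L v"
    using assms unfolding holomorphic_Cn_def by blast
  have lin: "linear (axis j :: complex \<Rightarrow> complex ^ 'n)"
    by (rule linearI) (simp_all add: vec_eq_iff axis_def)
  have axis_deriv: "((\<lambda>w. z + axis j w) has_derivative axis j) (at (0::complex))"
    using lin by (auto intro!: derivative_eq_intros bounded_linear_imp_has_derivative
        simp: linear_conv_bounded_linear)
  have "axis j w = w *s (axis j 1 :: complex ^ 'n)" for w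
    by (simp add: vec_eq_iff axis_def)
  then have "L (axis j w) = L (axis j 1) * w" for w
    using homog[of w "axis j 1"] by (metis mult.commute)
  then have "(\<lambda>w. L (axis j w)) = (\<lambda>w. L (axis j 1) * w)"
    by (rule ext)
  moreover have "((\<lambda>w. f (z + axis j w)) has_derivative (\<lambda>w. L (axis j w))) (at 0)"
    by (rule has_derivative_compose[OF axis_deriv]) (simp add: axis_zero L)
  ultimately have "((\<lambda>w. f (z + axis j w)) has_derivative (\<lambda>w. L (axis j 1) * w)) (at 0)"
    by (simp only:)
  then show "(\<lambda>w. f (z + axis j w)) field_differentiable at 0"
    by (auto simp: field_differentiable_def has_field_derivative_def)
qed

text \<open>
  Differentiability at the centre of every slice suffices for differentiability along it: a slice
  seen from one of its other points is again a slice, with a new centre.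
\<close>

lemma has_field_derivative_slice:
  assumes "cont_sep_holomorphic f G" and "z + axis j w \<in> G"
  shows "((\<lambda>w. f (z + axis j w)) has_field_derivative partial_z j f (z + axis j w)) (at w)"
proof -
  have "(\<lambda>h. f ((z + axis j w) + axis j h)) field_differentiable at 0"
    using assms unfolding cont_sep_holomorphic_def by blast
  then have "((\<lambda>h. f ((z + axis j w) + axis j h)) has_field_derivative partial_z j f (z + axis j w)) (at 0)"
    unfolding partial_z_def by (simp add: DERIV_deriv_iff_field_differentiable)
  moreover have "(\<lambda>h. f ((z + axis j w) + axis j h)) = (\<lambda>h. f (z + axis j (h + w)))"
    by (simp add: axis_plus add.assoc add.commute[of "axis j w"])
  ultimately show ?thesis
    using DERIV_shift[of "\<lambda>w. f (z + axis j w)" _ 0 w] by simp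
qed

lemma holomorphic_on_slice:
  assumes "cont_sep_holomorphic f G" and "\<And>w. w \<in> S \<Longrightarrow> z + axis j w \<in> G"
  shows "(\<lambda>w. f (z + axis j w)) holomorphic_on S"
  unfolding holomorphic_on_def field_differentiable_def
  using assms has_field_derivative_slice has_field_derivative_at_within by blast

lemma partial_z_cong:
  assumes "open G" "z \<in> G" and eq: "\<And>x. x \<in> G \<Longrightarrow> f x = g x"
  shows "partial_z j f z = partial_z j g z"
  unfolding partial_z_def
proof (rule deriv_cong_ev)
  obtain r where r: "r > 0" "ball z r \<subseteq> G"
    using assms open_contains_ball by blast
  then have "eventually (\<lambda>w. w \<in> ball 0 r) (nhds (0::complex))"
    by (intro eventually_nhds_in_open) auto
  then show "\<forall>\<^sub>F w in nhds 0. f (z + axis j w) = g (z + axis j w)"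
    by eventually_elim (rule eq, use r in \<open>auto simp: dist_norm norm_axis subset_iff\<close>)
qed simp

section \<open>Cauchy estimates and mixed partial derivatives\<close>

lemma add_axis_in_cball: "norm w \<le> r \<Longrightarrow> z + axis j w \<in> cball z r"
  for z :: "'a::real_normed_vector ^ 'n"
  by (simp add: dist_norm norm_axis)

lemma partial_z_Cauchy_estimate:
  assumes f: "cont_sep_holomorphic f G" and "r > 0" and "cball z r \<subseteq> G"
    and "\<And>x. x \<in> cball z r \<Longrightarrow> norm (f x) \<le> B"
  shows "norm (partial_z j f z) \<le> B / r"
proof -
  have hol: "(\<lambda>w. f (z + axis j w)) holomorphic_on cball 0 r"
    using f by (rule holomorphic_on_slice) (use \<open>cball z r \<subseteq> G\<close> add_axis_in_cball in force)
  have "norm ((deriv ^^ 1) (\<lambda>w. f (z + axis j w)) 0) \<le> fact 1 * B / r ^ 1"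
  proof (rule Cauchy_inequality)
    show "(\<lambda>w. f (z + axis j w)) holomorphic_on ball 0 r"
      using hol ball_subset_cball by (rule holomorphic_on_subset)
    show "continuous_on (cball 0 r) (\<lambda>w. f (z + axis j w))"
      using hol by (rule holomorphic_on_imp_continuous_on)
    show "norm (f (z + axis j w)) \<le> B" if "norm (0 - w) = r" for w
      using that by (intro assms(4) add_axis_in_cball) simp
  qed fact
  then show ?thesis
    by (simp add: partial_z_def)
qed

text \<open>
  The difference of the slices through two nearby points is uniformly small on a circle, as \<open>f\<close> is
  uniformly continuous on compact sets; the one-variable Cauchy inequality turns this into a small
  difference of derivatives.
\<close>

lemma continuous_on_partial_z:
  assumes f: "cont_sep_holomorphic f G" and "open G"
  shows "continuous_on G (partial_z j f)"
  unfolding continuous_on_iff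
proof (intro ballI allI impI)
  fix z and e :: real
  assume "z \<in> G" "e > 0"
  obtain R where "R > 0" and R: "cball z R \<subseteq> G"
    using \<open>open G\<close> \<open>z \<in> G\<close> open_contains_cball by blast
  define r where "r = R / 2"
  have "r > 0"
    using \<open>R > 0\<close> by (simp add: r_def)
  have "uniformly_continuous_on (cball z R) f"
    using f R unfolding cont_sep_holomorphic_def
    by (meson compact_cball compact_uniformly_continuous continuous_on_subset)
  then obtain d where "d > 0"
    and d: "\<And>x y. x \<in> cball z R \<Longrightarrow> y \<in> cball z R \<Longrightarrow> dist y x < d \<Longrightarrow> dist (f y) (f x) < e / 2 * r"
    using \<open>e > 0\<close> \<open>r > 0\<close> unfolding uniformly_continuous_on_def
    by (metis half_gt_zero mult_pos_pos)
  show "\<exists>d>0. \<forall>y\<in>G. dist y z < d \<longrightarrow> dist (partial_z j f y) (partial_z j f z) < e"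
  proof (intro exI[of _ "min d r"] conjI ballI impI)
    show "min d r > 0"
      using \<open>d > 0\<close> \<open>r > 0\<close> by simp
    fix y assume "y \<in> G" and y: "dist y z < min d r"
    define \<phi> where "\<phi> = (\<lambda>p w. f (p + axis j w))"
    have near: "z + axis j w \<in> cball z R" "y + axis j w \<in> cball z R" if "norm w \<le> r" for w
    proof -
      have "dist z (z + axis j w) \<le> r" "dist y (y + axis j w) \<le> r"
        using that by (simp_all add: dist_norm norm_axis)
      with y \<open>r > 0\<close> dist_triangle[of z "y + axis j w" y] show
        "z + axis j w \<in> cball z R" "y + axis j w \<in> cball z R"
        by (simp_all add: r_def dist_commute)
    qed
    have hol: "\<phi> z holomorphic_on cball 0 r" "\<phi> y holomorphic_on cball 0 r"
      unfolding \<phi>_def using near R by (auto intro!: holomorphic_on_slice[OF f])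
    have "norm ((deriv ^^ 1) (\<lambda>w. \<phi> y w - \<phi> z w) 0) \<le> fact 1 * (e / 2 * r) / r ^ 1"
    proof (rule Cauchy_inequality)
      have diff: "(\<lambda>w. \<phi> y w - \<phi> z w) holomorphic_on cball 0 r"
        using hol by (intro holomorphic_intros)
      show "(\<lambda>w. \<phi> y w - \<phi> z w) holomorphic_on ball 0 r"
        using diff ball_subset_cball by (rule holomorphic_on_subset)
      show "continuous_on (cball 0 r) (\<lambda>w. \<phi> y w - \<phi> z w)"
        using diff by (rule holomorphic_on_imp_continuous_on)
      show "norm (\<phi> y w - \<phi> z w) \<le> e / 2 * r" if "norm (0 - w) = r" for w
      proof -
        have "dist (y + axis j w) (z + axis j w) < d"
          using y by simp
        with near[of w] d[of "z + axis j w" "y + axis j w"] that show ?thesis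
          by (simp add: \<phi>_def dist_norm)
      qed
    qed fact
    moreover have "deriv (\<lambda>w. \<phi> y w - \<phi> z w) 0 = partial_z j f y - partial_z j f z"
      unfolding partial_z_def \<phi>_def using f \<open>y \<in> G\<close> \<open>z \<in> G\<close>
      by (intro deriv_diff) (auto simp: cont_sep_holomorphic_def)
    ultimately show "dist (partial_z j f y) (partial_z j f z) < e"
      using \<open>e > 0\<close> \<open>r > 0\<close> by (simp add: dist_norm)
  qed
qed

text \<open>
  Along direction \<open>k\<close>, the partial derivative in direction \<open>j\<close> is the limit as \<open>h \<rightarrow> 0\<close> of the
  difference quotients \<open>(f(z + h e\<^sub>j) - f(z)) / h\<close>, which are holomorphic in the \<open>k\<close>-th variable. By
  the mean value inequality the error is at most the oscillation of the partial derivative over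
  distance \<open>norm h\<close>, hence uniformly small by the continuity already known; locally uniform limits
  of holomorphic functions of one variable are holomorphic.
\<close>

lemma cont_sep_holomorphic_partial_z:
  fixes G :: "(complex ^ 'n) set"
  assumes f: "cont_sep_holomorphic f G" and "open G"
  shows "cont_sep_holomorphic (partial_z j f) G"
  unfolding cont_sep_holomorphic_def
proof (intro conjI ballI allI)
  show cont: "continuous_on G (partial_z j f)"
    using assms by (rule continuous_on_partial_z)
  fix z k assume "z \<in> G"
  obtain R where "R > 0" and R: "cball z R \<subseteq> G"
    using \<open>open G\<close> \<open>z \<in> G\<close> open_contains_cball by blast
  \<comment> \<open>Two displacements of size at most \<open>r\<close>, one in each direction, stay in the ball of radius \<open>R\<close>.\<close>
  define r where "r = R / 2"
  have "r > 0"
    using \<open>R > 0\<close> by (simp add: r_def)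
  have near: "z + axis k s + axis j h \<in> cball z R" if "norm s \<le> r" "norm h \<le> r" for s h
  proof -
    have "norm (axis k s + axis j h :: complex ^ 'n) \<le> r + r"
      using that norm_triangle_mono[of "axis k s :: complex ^ 'n" r "axis j h" r]
      by (simp add: norm_axis)
    moreover have "dist z (z + axis k s + axis j h) = norm (axis k s + axis j h :: complex ^ 'n)"
      by (metis add.assoc add_diff_cancel_left' dist_commute dist_norm)
    ultimately show ?thesis
      by (simp add: r_def)
  qed
  define q where "q = (\<lambda>h s. (f (z + axis k s + axis j h) - f (z + axis k s)) / h)"
  have lim: "uniform_limit (cball 0 r) q (\<lambda>s. partial_z j f (z + axis k s)) (at 0)"
  proof (rule uniform_limitI)
    fix e :: real assume "e > 0"
    have "uniformly_continuous_on (cball z R) (partial_z j f)"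
      using cont R by (meson compact_cball compact_uniformly_continuous continuous_on_subset)
    then obtain d where "d > 0"
      and d: "\<And>x y. x \<in> cball z R \<Longrightarrow> y \<in> cball z R \<Longrightarrow> dist y x < d \<Longrightarrow>
                dist (partial_z j f y) (partial_z j f x) < e / 2"
      using \<open>e > 0\<close> unfolding uniformly_continuous_on_def by (metis half_gt_zero)
    have "\<forall>\<^sub>F h in at 0. h \<in> ball (0::complex) (min d r) - {0}"
      using \<open>d > 0\<close> \<open>r > 0\<close> by (intro eventually_at_in_open) auto
    then show "\<forall>\<^sub>F h in at 0. \<forall>s\<in>cball 0 r. dist (q h s) (partial_z j f (z + axis k s)) < e"
    proof (eventually_elim, intro ballI)
      fix h s :: complex
      assume h: "h \<in> ball 0 (min d r) - {0}" and s: "s \<in> cball 0 r"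
      let ?p = "z + axis k s"
      \<comment> \<open>Subtracting the linear part makes the error of the quotient an increment of \<open>u\<close> over \<open>h\<close>.\<close>
      define u where "u = (\<lambda>t. f (?p + axis j t) - t * partial_z j f ?p)"
      have p: "?p \<in> cball z R"
        using near[of s 0] s \<open>r > 0\<close> by (simp add: axis_zero)
      have "norm (u h - u 0) \<le> e / 2 * norm (h - 0)"
      proof (rule field_differentiable_bound)
        fix t assume t: "t \<in> cball (0::complex) (norm h)"
        have pt: "?p + axis j t \<in> cball z R"
          using near[of s t] s h t by simp
        show "(u has_field_derivative partial_z j f (?p + axis j t) - partial_z j f ?p)
                (at t within cball 0 (norm h))"
          unfolding u_def using pt R
          by (auto intro!: derivative_eq_intros has_field_derivative_slice[OF f, THEN has_field_derivative_at_within])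
        have "dist (?p + axis j t) ?p < d"
          using h t by (simp add: dist_norm norm_axis)
        then show "norm (partial_z j f (?p + axis j t) - partial_z j f ?p) \<le> e / 2"
          using d[OF p pt] by (simp add: dist_norm)
      qed auto
      moreover have "q h s - partial_z j f ?p = (u h - u 0) / h"
        using h by (simp add: q_def u_def axis_zero field_simps)
      ultimately have "norm (q h s - partial_z j f ?p) \<le> e / 2"
        using h by (simp add: norm_divide pos_divide_le_eq)
      then show "dist (q h s) (partial_z j f ?p) < e"
        using \<open>e > 0\<close> by (simp add: dist_norm)
    qed
  qed
  have "\<forall>\<^sub>F h in at 0. h \<in> ball (0::complex) r - {0}"
    using \<open>r > 0\<close> by (intro eventually_at_in_open) auto
  then have "\<forall>\<^sub>F h in at 0. continuous_on (cball 0 r) (q h) \<and> q h holomorphic_on ball 0 r"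
  proof eventually_elim
    fix h :: complex assume h: "h \<in> ball 0 r - {0}"
    have "(\<lambda>s. f ((z + axis j h) + axis k s)) holomorphic_on cball 0 r"
    proof (rule holomorphic_on_slice[OF f])
      fix s :: complex assume "s \<in> cball 0 r"
      then have "z + axis k s + axis j h \<in> G"
        using near[of s h] h R by auto
      then show "z + axis j h + axis k s \<in> G"
        by (simp add: add_ac)
    qed
    moreover have "(\<lambda>s. f (z + axis k s)) holomorphic_on cball 0 r"
      using near[of _ 0] \<open>r > 0\<close> R by (intro holomorphic_on_slice[OF f]) (auto simp: axis_zero)
    ultimately have "q h holomorphic_on cball 0 r"
      unfolding q_def using h by (auto intro!: holomorphic_intros simp: add_ac)
    then show "continuous_on (cball 0 r) (q h) \<and> q h holomorphic_on ball 0 r"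
      using holomorphic_on_imp_continuous_on holomorphic_on_subset ball_subset_cball by blast
  qed
  from holomorphic_uniform_limit[OF this lim]
  have "(\<lambda>s. partial_z j f (z + axis k s)) holomorphic_on ball 0 r"
    by auto
  then show "(\<lambda>s. partial_z j f (z + axis k s)) field_differentiable at 0"
    using \<open>r > 0\<close> by (intro holomorphic_on_imp_differentiable_at[of _ "ball 0 r"]) auto
qed

lemma mixed_partial_induct:
  assumes "P (\<lambda>f. f)" and step: "\<And>T j. P T \<Longrightarrow> P (\<lambda>f. partial_z j (T f))"
  shows "P (mixed_partial a)"
proof -
  have pow: "P (\<lambda>f. (partial_z j ^^ n) (T f))" if "P T" for j n T
    using that by (induction n) (simp_all add: step)
  have "P (foldr (\<lambda>j. partial_z j ^^ a j) js)" for js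
  proof (induction js)
    case Nil
    then show ?case using assms(1) by (simp add: id_def)
  next
    case (Cons j js)
    then show ?case using pow[of "foldr (\<lambda>j. partial_z j ^^ a j) js" "a j" j] by (simp add: o_def)
  qed
  then show ?thesis
    by (simp add: mixed_partial_def[abs_def])
qed

lemma mixed_partial_cong:
  assumes "open G" and "\<And>x. x \<in> G \<Longrightarrow> f x = g x" and "z \<in> G"
  shows "mixed_partial a f z = mixed_partial a g z"
proof -
  have "\<forall>z\<in>G. mixed_partial a f z = mixed_partial a g z"
  proof (rule mixed_partial_induct[where P = "\<lambda>T. \<forall>z\<in>G. T f z = T g z"])
    show "\<forall>z\<in>G. partial_z j (T f) z = partial_z j (T g) z"
      if "\<forall>z\<in>G. T f z = T g z" for T j
      using that partial_z_cong[OF \<open>open G\<close>] by blast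
  qed (use assms in simp)
  with \<open>z \<in> G\<close> show ?thesis by blast
qed

lemma cont_sep_holomorphic_mixed_partial:
  assumes "cont_sep_holomorphic f G" and "open G"
  shows "cont_sep_holomorphic (mixed_partial a f) G"
  by (rule mixed_partial_induct[where P = "\<lambda>T. cont_sep_holomorphic (T f) G"])
    (use assms cont_sep_holomorphic_partial_z in blast)+

text \<open>
  The larger compact set and the constant do not depend on \<open>f\<close>; this uniformity is what makes the
  estimate a continuity statement. Each partial derivative enlarges the compact set by some radius
  \<open>r\<close> and costs a factor \<open>1 / r\<close>.
\<close>

lemma mixed_partial_Cauchy_estimate:
  fixes G :: "(complex ^ 'n) set"
  assumes G: "open G" and "compact K" "K \<subseteq> G"
  obtains L C where "compact L" "L \<subseteq> G" "C > 0"
    and "\<And>f B z. cont_sep_holomorphic f G \<Longrightarrow> (\<And>x. x \<in> L \<Longrightarrow> norm (f x) \<le> B) \<Longrightarrow> z \<in> K \<Longrightarrow>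
           norm (mixed_partial a f z) \<le> C * B"
proof -
  define bounded_by where "bounded_by = (\<lambda>(T :: (complex ^ 'n \<Rightarrow> complex) \<Rightarrow> complex ^ 'n \<Rightarrow> complex) K L C.
    \<forall>f B. cont_sep_holomorphic f G \<longrightarrow> (\<forall>x\<in>L. norm (f x) \<le> B) \<longrightarrow>
      (\<forall>z\<in>K. norm (T f z) \<le> C * B))"
  let ?P = "\<lambda>T. (\<forall>f. cont_sep_holomorphic f G \<longrightarrow> cont_sep_holomorphic (T f) G) \<and>
    (\<forall>K. compact K \<longrightarrow> K \<subseteq> G \<longrightarrow> (\<exists>L C. compact L \<and> L \<subseteq> G \<and> C > 0 \<and> bounded_by T K L C))"
  have "?P (mixed_partial a)"
  proof (rule mixed_partial_induct)
    have "bounded_by (\<lambda>f. f) K K 1" for K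
      by (simp add: bounded_by_def)
    then show "?P (\<lambda>f. f)"
      using zero_less_one by blast
  next
    fix T j assume T: "?P T"
    have "\<exists>L C. compact L \<and> L \<subseteq> G \<and> C > 0 \<and> bounded_by (\<lambda>f. partial_z j (T f)) K L C"
      if K: "compact K" "K \<subseteq> G" for K
    proof -
      obtain r where "r > 0" and r: "(\<Union>x\<in>K. cball x r) \<subseteq> G"
        using K G by (metis compact_subset_open_imp_cball_epsilon_subset)
      have "compact (\<Union>x\<in>K. cball x r)"
        using K by (intro compact_minkowski_sum_cball)
      with T r obtain L C where L: "compact L" "L \<subseteq> G" "C > 0"
        and C: "bounded_by T (\<Union>x\<in>K. cball x r) L C"
        by meson
      have "bounded_by (\<lambda>f. partial_z j (T f)) K L (C / r)"
        unfolding bounded_by_def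
      proof (intro allI impI ballI)
        fix f B z
        assume f: "cont_sep_holomorphic f G" and B: "\<forall>x\<in>L. norm (f x) \<le> B" and z: "z \<in> K"
        have "norm (partial_z j (T f) z) \<le> C * B / r"
        proof (rule partial_z_Cauchy_estimate)
          show "cont_sep_holomorphic (T f) G"
            using T f by blast
          show "cball z r \<subseteq> G"
            using z r by blast
          show "norm (T f x) \<le> C * B" if "x \<in> cball z r" for x
            using C f B z that unfolding bounded_by_def by blast
        qed fact
        then show "norm (partial_z j (T f) z) \<le> C / r * B"
          by simp
      qed
      with L \<open>r > 0\<close> show ?thesis
        by (meson divide_pos_pos)
    qed
    moreover have "cont_sep_holomorphic (partial_z j (T f)) G" if "cont_sep_holomorphic f G" for f
      using T that cont_sep_holomorphic_partial_z[OF _ G] by blast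
    ultimately show "?P (\<lambda>f. partial_z j (T f))"
      by (intro conjI allI impI)
  qed
  then obtain L C where "compact L" "L \<subseteq> G" "C > 0" "bounded_by (mixed_partial a) K L C"
    using assms by meson
  then show ?thesis
    using that[of L C] unfolding bounded_by_def by simp
qed

section \<open>Seminorm topologies\<close>

lemma sup_seminorm_le:
  assumes "0 \<le> B" and "\<And>z. z \<in> S \<Longrightarrow> norm (f z) \<le> B"
  shows "sup_seminorm S f \<le> B"
  unfolding sup_seminorm_def using assms by (intro cSup_least) auto

lemma sup_seminorm_cong:
  assumes "\<And>z. z \<in> S \<Longrightarrow> f z = g z"
  shows "sup_seminorm S f = sup_seminorm S g"
  unfolding sup_seminorm_def by (simp add: assms cong: image_cong)

lemma bdd_above_norm_compact:
  assumes "compact K" "continuous_on K f"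
  shows "bdd_above (insert 0 ((\<lambda>z. norm (f z)) ` K))"
  using compact_imp_bounded[OF compact_continuous_image[OF continuous_on_norm[OF assms(2)] assms(1)]]
  by (simp add: bounded_imp_bdd_above)

lemma norm_le_sup_seminorm:
  assumes "compact K" "continuous_on K f" "z \<in> K"
  shows "norm (f z) \<le> sup_seminorm K f"
  unfolding sup_seminorm_def
  by (rule cSup_upper) (use assms bdd_above_norm_compact in auto)

lemma sup_seminorm_nonneg:
  assumes "compact K" "continuous_on K f"
  shows "0 \<le> sup_seminorm K f"
  unfolding sup_seminorm_def
  by (rule cSup_upper) (use assms bdd_above_norm_compact in auto)

lemma sup_seminorm_triangle:
  assumes "compact K" and cont: "continuous_on K f" "continuous_on K g" "continuous_on K h"
  shows "sup_seminorm K (\<lambda>z. h z - f z) \<le> sup_seminorm K (\<lambda>z. h z - g z) + sup_seminorm K (\<lambda>z. g z - f z)"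
proof -
  have hg: "continuous_on K (\<lambda>z. h z - g z)" and gf: "continuous_on K (\<lambda>z. g z - f z)"
    using cont by (auto intro: continuous_on_diff)
  show ?thesis
  proof (rule sup_seminorm_le)
    show "0 \<le> sup_seminorm K (\<lambda>z. h z - g z) + sup_seminorm K (\<lambda>z. g z - f z)"
      using sup_seminorm_nonneg[OF \<open>compact K\<close>] hg gf by (simp add: add_nonneg_nonneg)
    fix z assume "z \<in> K"
    have "norm (h z - f z) \<le> norm (h z - g z) + norm (g z - f z)"
      using norm_triangle_ineq[of "h z - g z" "g z - f z"] by simp
    also have "\<dots> \<le> sup_seminorm K (\<lambda>z. h z - g z) + sup_seminorm K (\<lambda>z. g z - f z)"
      using norm_le_sup_seminorm[OF \<open>compact K\<close> _ \<open>z \<in> K\<close>] hg gf by (intro add_mono)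
    finally show "norm (h z - f z) \<le> sup_seminorm K (\<lambda>z. h z - g z) + sup_seminorm K (\<lambda>z. g z - f z)" .
  qed
qed

text \<open>
  Each seminorm may be controlled separately, since a basic neighbourhood involves only finitely many
  of them and finitely many open sets of the source can be intersected.
\<close>

lemma continuous_map_into_seminorm_topology:
  assumes into: "\<And>x. x \<in> topspace X \<Longrightarrow> T x \<in> S"
    and nbhd: "\<And>x p e. x \<in> topspace X \<Longrightarrow> p \<in> P \<Longrightarrow> e > 0 \<Longrightarrow>
           \<exists>V. openin X V \<and> x \<in> V \<and> (\<forall>y\<in>V. p (\<lambda>z. T y z - T x z) < e)"
  shows "continuous_map X (seminorm_topology S P) T"
  unfolding continuous_map_def
proof (intro conjI allI impI)
  show "T \<in> topspace X \<rightarrow> topspace (seminorm_topology S P)"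
    using into by simp
  fix U assume U: "openin (seminorm_topology S P) U"
  show "openin X {x \<in> topspace X. T x \<in> U}"
  proof (subst openin_subopen, intro ballI)
    fix x assume "x \<in> {x \<in> topspace X. T x \<in> U}"
    then have x: "x \<in> topspace X" "T x \<in> U" by auto
    with U obtain F e where F: "finite F" "F \<subseteq> P" "e > 0"
      and sub: "{g \<in> S. \<forall>p\<in>F. p (\<lambda>z. g z - T x z) < e} \<subseteq> U"
      unfolding openin_seminorm_topology by meson
    have "\<forall>p\<in>F. \<exists>V. openin X V \<and> x \<in> V \<and> (\<forall>y\<in>V. p (\<lambda>z. T y z - T x z) < e)"
      using F x nbhd by blast
    then obtain V where V: "\<And>p. p \<in> F \<Longrightarrow> openin X (V p) \<and> x \<in> V p \<and> (\<forall>y\<in>V p. p (\<lambda>z. T y z - T x z) < e)"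
      by metis
    let ?V = "topspace X \<inter> (\<Inter>p\<in>F. V p)"
    have "openin X ?V"
    proof (cases "F = {}")
      case False
      then have "openin X (\<Inter>p\<in>F. V p)"
        using F(1) V by (intro openin_INT2) auto
      then show ?thesis by blast
    qed simp
    moreover have "x \<in> ?V" "?V \<subseteq> {x \<in> topspace X. T x \<in> U}"
      using V x sub into by auto
    ultimately show "\<exists>V. openin X V \<and> x \<in> V \<and> V \<subseteq> {x \<in> topspace X. T x \<in> U}"
      by blast
  qed
qed

lemma continuous_on_H_set:
  assumes "f \<in> H_set G" "K \<subseteq> G"
  shows "continuous_on K f"
  using assms holomorphic_Cn_imp_continuous_on continuous_on_subset
  unfolding H_set_def by blast

text \<open>
  In a topology generated as in \<^const>\<open>seminorm_topology\<close> the balls themselves need not be open; here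
  the triangle inequality for suprema over compact sets makes them so.
\<close>

lemma openin_H_top_ball:
  assumes K: "compact K" "K \<subseteq> G" and f: "f \<in> H_set G"
  shows "openin (H_top G) {g \<in> H_set G. sup_seminorm K (\<lambda>z. g z - f z) < e}"
  unfolding H_top_def openin_seminorm_topology
proof (intro conjI ballI)
  fix g assume "g \<in> {g \<in> H_set G. sup_seminorm K (\<lambda>z. g z - f z) < e}"
  then have g: "g \<in> H_set G" "sup_seminorm K (\<lambda>z. g z - f z) < e" by auto
  have "sup_seminorm K (\<lambda>z. h z - f z) < e"
    if h: "h \<in> H_set G" "sup_seminorm K (\<lambda>z. h z - g z) < e - sup_seminorm K (\<lambda>z. g z - f z)" for h
    using sup_seminorm_triangle[of K f g h] h continuous_on_H_set[OF _ K(2)] f g K(1) by fastforce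
  then show "\<exists>F e'. finite F \<and> F \<subseteq> {sup_seminorm K |K. compact K \<and> K \<subseteq> G} \<and> 0 < e' \<and>
      {h \<in> H_set G. \<forall>p\<in>F. p (\<lambda>x. h x - g x) < e'} \<subseteq> {g \<in> H_set G. sup_seminorm K (\<lambda>z. g z - f z) < e}"
    using K g
    by (intro exI[of _ "{sup_seminorm K}"] exI[of _ "e - sup_seminorm K (\<lambda>z. g z - f z)"]) auto
qed auto

section \<open>Restriction and gluing of holomorphic functions\<close>

lemma holomorphic_Cn_cong:
  assumes "open W" "holomorphic_Cn f W" "\<And>z. z \<in> W \<Longrightarrow> f z = g z"
  shows "holomorphic_Cn g W"
  unfolding holomorphic_Cn_def
proof
  fix z assume z: "z \<in> W"
  then obtain L where L: "(f has_derivative L) (at z)" "\<forall>c v. L (c *s v) = c * L v"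
    using assms(2) unfolding holomorphic_Cn_def by blast
  have "(g has_derivative L) (at z)"
    using L(1) assms(1) z assms(3) by (rule has_derivative_transform_within_open)
  with L(2) show "\<exists>L. (g has_derivative L) (at z) \<and> (\<forall>c v. L (c *s v) = c * L v)"
    by blast
qed

lemma holomorphic_Cn_diff:
  assumes f: "holomorphic_Cn f G" and g: "holomorphic_Cn g G"
  shows "holomorphic_Cn (\<lambda>z. f z - g z) G"
  unfolding holomorphic_Cn_def
proof
  fix z assume "z \<in> G"
  then obtain L M where "(f has_derivative L) (at z)" "(g has_derivative M) (at z)"
    and "\<And>c v. L (c *s v) = c * L v" "\<And>c v. M (c *s v) = c * M v"
    using f g unfolding holomorphic_Cn_def by meson
  then show "\<exists>L. ((\<lambda>z. f z - g z) has_derivative L) (at z) \<and> (\<forall>c v. L (c *s v) = c * L v)"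
    by (intro exI[of _ "\<lambda>v. L v - M v"]) (auto intro: has_derivative_diff simp: right_diff_distrib)
qed

lemma restrict_in_A_inf_set:
  assumes f: "f \<in> H_set G" and "open G" "open W" "closure W \<subseteq> G"
  shows "restrict f W \<in> A_inf_set W"
proof -
  have hol: "holomorphic_Cn f G" using f by (simp add: H_set_def)
  have "W \<subseteq> G" using assms closure_subset by blast
  with hol have "holomorphic_Cn f W"
    unfolding holomorphic_Cn_def by blast
  with \<open>open W\<close> have "holomorphic_Cn (restrict f W) W"
    by (rule holomorphic_Cn_cong) simp
  moreover have "\<exists>h. continuous_on (closure W) h \<and> (\<forall>z\<in>W. h z = mixed_partial a (restrict f W) z)" for a
  proof (intro exI conjI ballI)
    have "cont_sep_holomorphic (mixed_partial a f) G"
      using hol \<open>open G\<close>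
      by (intro cont_sep_holomorphic_mixed_partial holomorphic_Cn_imp_cont_sep_holomorphic)
    then show "continuous_on (closure W) (mixed_partial a f)"
      using assms continuous_on_subset unfolding cont_sep_holomorphic_def by blast
    show "mixed_partial a f z = mixed_partial a (restrict f W) z" if "z \<in> W" for z
      using \<open>open W\<close> _ that by (rule mixed_partial_cong) simp
  qed
  ultimately show ?thesis
    by (simp add: A_inf_set_def H_set_def)
qed

lemma continuous_map_restrict_A_inf:
  fixes G :: "(complex ^ 'n) set"
  assumes "open G" "open W" "compact (closure W)" "closure W \<subseteq> G"
  shows "continuous_map (H_top G) (A_inf_top W) (\<lambda>f. restrict f W)"
  unfolding A_inf_top_def
proof (rule continuous_map_into_seminorm_topology)
  show "restrict f W \<in> A_inf_set W" if "f \<in> topspace (H_top G)" for f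
    using that assms by (auto simp: H_top_def intro: restrict_in_A_inf_set)
  fix f p and e :: real
  assume "f \<in> topspace (H_top G)" and "e > 0"
    and "p \<in> range (\<lambda>a f. sup_seminorm W (mixed_partial a f))"
  then obtain a where f: "f \<in> H_set G" and p: "p = (\<lambda>f. sup_seminorm W (mixed_partial a f))"
    by (auto simp: H_top_def)
  obtain L C where L: "compact L" "L \<subseteq> G" and "C > 0"
    and est: "\<And>f B z. cont_sep_holomorphic f G \<Longrightarrow> (\<And>x. x \<in> L \<Longrightarrow> norm (f x) \<le> B) \<Longrightarrow>
                z \<in> closure W \<Longrightarrow> norm (mixed_partial a f z) \<le> C * B"
    using mixed_partial_Cauchy_estimate[of G "closure W" a] assms by metis
  let ?V = "{g \<in> H_set G. sup_seminorm L (\<lambda>z. g z - f z) < e / C}"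
  have "p (\<lambda>z. restrict g W z - restrict f W z) < e" if g: "g \<in> ?V" for g
  proof -
    let ?s = "sup_seminorm L (\<lambda>z. g z - f z)"
    have cont: "continuous_on L (\<lambda>z. g z - f z)"
      using f g L(2) by (auto intro!: continuous_on_diff intro: continuous_on_H_set)
    have "p (\<lambda>z. restrict g W z - restrict f W z) \<le> C * ?s"
      unfolding p
    proof (rule sup_seminorm_le)
      show "0 \<le> C * ?s"
        using \<open>C > 0\<close> sup_seminorm_nonneg[OF L(1) cont] by simp
      fix z assume z: "z \<in> W"
      have "mixed_partial a (\<lambda>z. restrict g W z - restrict f W z) z = mixed_partial a (\<lambda>z. g z - f z) z"
        using \<open>open W\<close> _ z by (rule mixed_partial_cong) simp
      moreover have "norm (mixed_partial a (\<lambda>z. g z - f z) z) \<le> C * ?s"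
      proof (rule est)
        show "cont_sep_holomorphic (\<lambda>z. g z - f z) G"
          using f g unfolding H_set_def
          by (auto intro: holomorphic_Cn_imp_cont_sep_holomorphic holomorphic_Cn_diff)
        show "norm (g x - f x) \<le> ?s" if "x \<in> L" for x
          using norm_le_sup_seminorm[OF L(1) cont that] .
        show "z \<in> closure W"
          using z closure_subset by blast
      qed
      ultimately show "norm (mixed_partial a (\<lambda>z. restrict g W z - restrict f W z) z) \<le> C * ?s"
        by simp
    qed
    also have "\<dots> < e"
      using g \<open>C > 0\<close> by (simp add: pos_less_divide_eq mult.commute)
    finally show ?thesis .
  qed
  moreover have "openin (H_top G) ?V"
    using L f by (rule openin_H_top_ball)
  moreover have "f \<in> ?V"
  proof -
    have "sup_seminorm L (\<lambda>z. f z - f z) \<le> 0"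
      by (rule sup_seminorm_le) auto
    also have "0 < e / C"
      using \<open>e > 0\<close> \<open>C > 0\<close> by simp
    finally show ?thesis
      using f by simp
  qed
  ultimately show "\<exists>V. openin (H_top G) V \<and> f \<in> V \<and>
      (\<forall>g\<in>V. p (\<lambda>z. restrict g W z - restrict f W z) < e)"
    by blast
qed

theorem theorem4p2:
  fixes \<Omega> :: "(complex ^ 'n) set"
    and K :: "nat \<Rightarrow> (complex ^ 'n) set"
    and X :: "nat \<Rightarrow> (complex ^ 'n \<Rightarrow> complex) topology"
  assumes "open \<Omega>"
    and "\<And>m. m \<ge> 1 \<Longrightarrow> compact (K m)"
    and "\<And>m. m \<ge> 1 \<Longrightarrow> K m \<subseteq> \<Omega>"
    and "\<And>m. m \<ge> 1 \<Longrightarrow> K m \<subseteq> interior (K (Suc m))"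
    and "(\<Union>m\<in>{1..}. K m) = \<Omega>"
    and "\<And>m. m \<ge> 1 \<Longrightarrow> X m \<in> class_M (interior (K m))"
  shows "projective_limit X (\<lambda>m n f. restrict f (interior (K n))) homeomorphic_space H_top \<Omega>"
proof -
  define W where "W = (\<lambda>n. interior (K n))"
  let ?Y = "projective_limit X (\<lambda>m n f. restrict f (interior (K n)))"
  have openW: "open (W n)" for n
    by (simp add: W_def)
  have closW: "closure (W n) \<subseteq> K n" if "n \<ge> 1" for n
    unfolding W_def using assms(2)[OF that]
    by (simp add: closure_minimal compact_imp_closed interior_subset)
  then have compW: "compact (closure (W n))" if "n \<ge> 1" for n
    using assms(2)[OF that] that by (metis closed_closure compact_Int_closed inf.absorb_iff2)
  have subW: "closure (W n) \<subseteq> \<Omega>" "W n \<subseteq> \<Omega>" if "n \<ge> 1" for n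
    using closW[OF that] assms(3)[OF that] closure_subset[of "W n"] by auto
  have monoW: "W n \<subseteq> W m" if "1 \<le> n" "n \<le> m" for n m
    using that(2)
  proof (induction rule: dec_induct)
    case (step i)
    moreover have "W i \<subseteq> W (Suc i)"
      using assms(4)[of i] step.hyps that(1) interior_subset[of "K i"] by (auto simp: W_def)
    ultimately show ?case by blast
  qed simp
  have ex_W: "\<exists>n\<ge>1. x \<in> W n" if x: "x \<in> \<Omega>" for x
  proof -
    obtain m where "m \<ge> 1" "x \<in> K m" using x assms(5) by auto
    then show ?thesis
      using assms(4)[of m] by (intro exI[of _ "Suc m"]) (auto simp: W_def)
  qed
  have compact_in_W: "\<exists>n\<ge>1. L \<subseteq> W n" if L: "compact L" "L \<subseteq> \<Omega>" for L
  proof -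
    have "L \<subseteq> (\<Union>n\<in>{1..}. W n)"
      using L(2) ex_W by force
    then obtain D where D: "D \<subseteq> {1..}" "finite D" "L \<subseteq> (\<Union>n\<in>D. W n)"
      using compactE_image[OF L(1), of "{1..}" W] openW by metis
    have "W n \<subseteq> W (Max (insert 1 D))" if "n \<in> D" for n
      using that D by (intro monoW) auto
    with D show ?thesis
      by (intro exI[of _ "Max (insert 1 D)"]) auto
  qed
  have H_X: "topspace (X n) \<subseteq> H_set (W n)" "continuous_map (X n) (H_top (W n)) (\<lambda>g. g)"
    "continuous_map (A_inf_top (W n)) (X n) (\<lambda>f. f)" if "n \<ge> 1" for n
    using assms(6)[OF that] by (auto simp: class_M_def W_def)
  define \<Phi> :: "(complex ^ 'n \<Rightarrow> complex) \<Rightarrow> nat \<Rightarrow> complex ^ 'n \<Rightarrow> complex"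
    where "\<Phi> f = (\<lambda>n\<in>{1..}. restrict f (W n))" for f
  define \<Psi> :: "(nat \<Rightarrow> complex ^ 'n \<Rightarrow> complex) \<Rightarrow> complex ^ 'n \<Rightarrow> complex"
    where "\<Psi> g = (\<lambda>x\<in>\<Omega>. g (LEAST n. n \<ge> 1 \<and> x \<in> W n) x)" for g
  have topY: "topspace ?Y = {g \<in> PiE {1..} (\<lambda>n. topspace (X n)).
      \<forall>n m. 1 \<le> n \<longrightarrow> n \<le> m \<longrightarrow> restrict (g m) (W n) = g n}"
    by (auto simp: projective_limit_def W_def)
  have glue: "\<Psi> g x = g n x" if g: "g \<in> topspace ?Y" and n: "n \<ge> 1" "x \<in> W n" for g n x
  proof -
    let ?l = "LEAST n. n \<ge> 1 \<and> x \<in> W n"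
    have l: "?l \<ge> 1 \<and> x \<in> W ?l"
      by (rule LeastI[of _ n]) (use n in auto)
    have "?l \<le> n"
      by (rule Least_le) (use n in auto)
    moreover have "\<forall>i m. 1 \<le> i \<longrightarrow> i \<le> m \<longrightarrow> restrict (g m) (W i) = g i"
      using g by (simp add: topY)
    ultimately have "restrict (g n) (W ?l) = g ?l"
      using l by blast
    from fun_cong[OF this, of x] have "g ?l x = g n x"
      using l by simp
    then show ?thesis
      using subW n by (auto simp: \<Psi>_def)
  qed
  have \<Psi>_H: "\<Psi> g \<in> H_set \<Omega>" if g: "g \<in> topspace ?Y" for g
  proof -
    have "holomorphic_Cn (\<Psi> g) \<Omega>"
      unfolding holomorphic_Cn_def
    proof
      fix x assume "x \<in> \<Omega>"
      then obtain n where n: "n \<ge> 1" "x \<in> W n" using ex_W by blast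
      then have "g n \<in> H_set (W n)"
        using g H_X(1)[of n] by (auto simp: topY PiE_def)
      then have "holomorphic_Cn (g n) (W n)"
        by (simp add: H_set_def)
      with openW have "holomorphic_Cn (\<Psi> g) (W n)"
        by (rule holomorphic_Cn_cong) (simp add: glue[OF g n(1)])
      with n show "\<exists>L. (\<Psi> g has_derivative L) (at x) \<and> (\<forall>c v. L (c *s v) = c * L v)"
        unfolding holomorphic_Cn_def by blast
    qed
    then show ?thesis
      by (auto simp: H_set_def \<Psi>_def)
  qed
  have \<Phi>: "continuous_map (H_top \<Omega>) ?Y \<Phi>"
    unfolding projective_limit_def continuous_map_in_subtopology
  proof
    have "continuous_map (H_top \<Omega>) (X n) (\<lambda>f. restrict f (W n))" if "n \<ge> 1" for n
      using continuous_map_compose[OF continuous_map_restrict_A_inf[OF \<open>open \<Omega>\<close> openW compW[OF that] subW(1)[OF that]] H_X(3)[OF that]]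
      by (simp add: o_def)
    then show "continuous_map (H_top \<Omega>) (product_topology X {1..}) \<Phi>"
      by (auto simp: continuous_map_componentwise \<Phi>_def cong: restrict_cong)
    have "restrict (\<Phi> f m) (W n) = \<Phi> f n" if "1 \<le> n" "n \<le> m" for f n m
      using that monoW[OF that] by (simp add: \<Phi>_def Int_absorb1)
    then show "\<Phi> \<in> topspace (H_top \<Omega>) \<rightarrow> {g. \<forall>n m. 1 \<le> n \<longrightarrow> n \<le> m \<longrightarrow> restrict (g m) (interior (K n)) = g n}"
      by (simp add: W_def)
  qed
  have \<Psi>: "continuous_map ?Y (H_top \<Omega>) \<Psi>"
    unfolding H_top_def
  proof (rule continuous_map_into_seminorm_topology)
    show "\<Psi> g \<in> H_set \<Omega>" if "g \<in> topspace ?Y" for g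
      using that by (rule \<Psi>_H)
    fix g p and e :: real
    assume g: "g \<in> topspace ?Y" and "e > 0"
      and "p \<in> {sup_seminorm L |L. compact L \<and> L \<subseteq> \<Omega>}"
    then obtain L where p: "p = sup_seminorm L" and L: "compact L" "L \<subseteq> \<Omega>" by blast
    obtain n where n: "n \<ge> 1" "L \<subseteq> W n" using compact_in_W[OF L] by blast
    have gn: "g n \<in> H_set (W n)"
      using g n H_X(1)[of n] by (auto simp: topY PiE_def)
    \<comment> \<open>The seminorm over \<open>L\<close> of a glued function depends on the \<open>n\<close>-th coordinate alone, so the
      neighbourhood can be pulled back along that coordinate.\<close>
    let ?U = "{h \<in> H_set (W n). sup_seminorm L (\<lambda>z. h z - g n z) < e}"
    have "continuous_map ?Y (X n) (\<lambda>h. h n)"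
      unfolding projective_limit_def using n
      by (intro continuous_map_from_subtopology continuous_map_product_projection) auto
    then have "continuous_map ?Y (H_top (W n)) (\<lambda>h. h n)"
      using continuous_map_compose[OF _ H_X(2)[OF n(1)]] by (auto simp: o_def)
    then have "openin ?Y {h \<in> topspace ?Y. h n \<in> ?U}"
      using openin_H_top_ball[OF L(1) n(2) gn] by (rule openin_continuous_map_preimage)
    moreover have "sup_seminorm L (\<lambda>z. g n z - g n z) < e"
      using sup_seminorm_le[of 0 L "\<lambda>z. g n z - g n z"] \<open>e > 0\<close> by simp
    then have "g \<in> {h \<in> topspace ?Y. h n \<in> ?U}"
      using g gn by simp
    moreover have "p (\<lambda>z. \<Psi> h z - \<Psi> g z) < e" if h: "h \<in> {h \<in> topspace ?Y. h n \<in> ?U}" for h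
    proof -
      have "p (\<lambda>z. \<Psi> h z - \<Psi> g z) = sup_seminorm L (\<lambda>z. h n z - g n z)"
        unfolding p using h g n glue by (intro sup_seminorm_cong) auto
      then show ?thesis using h by simp
    qed
    ultimately show "\<exists>V. openin ?Y V \<and> g \<in> V \<and> (\<forall>h\<in>V. p (\<lambda>z. \<Psi> h z - \<Psi> g z) < e)"
      by blast
  qed
  have "\<Phi> (\<Psi> g) = g" if g: "g \<in> topspace ?Y" for g
  proof
    fix n
    show "\<Phi> (\<Psi> g) n = g n"
    proof (cases "n \<ge> 1")
      case True
      then have "g n \<in> extensional (W n)"
        using g H_X(1)[of n] by (auto simp: topY PiE_def H_set_def)
      then have "restrict (\<Psi> g) (W n) = g n"
        using glue[OF g True] by (intro extensionalityI[where A = "W n"]) auto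
      with True show ?thesis by (simp add: \<Phi>_def)
    next
      case False
      with g show ?thesis by (auto simp: \<Phi>_def topY PiE_def extensional_def)
    qed
  qed
  moreover have "\<Psi> (\<Phi> f) = f" if f: "f \<in> topspace (H_top \<Omega>)" for f
  proof
    fix x
    have ext: "f \<in> extensional \<Omega>"
      using f by (auto simp: H_top_def H_set_def)
    show "\<Psi> (\<Phi> f) x = f x"
    proof (cases "x \<in> \<Omega>")
      case True
      then obtain n where n: "n \<ge> 1" "x \<in> W n" using ex_W by blast
      have "\<Phi> f \<in> topspace ?Y"
        using f \<Phi> by (auto simp: continuous_map_def)
      from glue[OF this n] n show ?thesis by (simp add: \<Phi>_def)
    next
      case False
      with ext show ?thesis by (simp add: \<Psi>_def extensional_def)
    qed
  qed
  ultimately have "homeomorphic_maps ?Y (H_top \<Omega>) \<Psi> \<Phi>"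
    using \<Phi> \<Psi> by (simp add: homeomorphic_maps_def)
  then show ?thesis
    unfolding homeomorphic_space_def by blast
qed

end
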